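(* Let $0<\alpha<1/2$, let $\xi_1,\xi_2,\ldots$ be i.i.d. random variables with distribution function $F\in K$ with left endpoint $a=0$, let $G(x)=\mathbf P(\xi_1\ge x)=1-F(x)$, and fix $x>0$. **A.** Suppose that the fractional derivative $G^{(\alpha)}(x)$ exists at the point $x$. Then the estimate $G_{\alpha,n}(x)$ is unbiased: for every $n\ge 1$, $$\mathbf E\, G_{\alpha,n}(x)=G^{(\alpha)}(x).$$ **B.** Suppose in addition that the fractional derivative $G^{(2\alpha)}(x)$ exists at the point $x$. Then for every $n\ge1$ $$\operatorname{Var}\left[G_{\alpha,n}(x)\right]=\frac{\Sigma_\alpha^2(x)}{n\,\Gamma^2(1-\alpha)},$$ where $$\Sigma^2_{\alpha}(x)=2x^{-\alpha}\,\Gamma(1-\alpha)\,G^{(\alpha)}(x)-\Gamma(1-2\alpha)\,G^{(2\alpha)}(x)-\left(\Gamma(1-\alpha)\,G^{(\alpha)}(x)\right)^2,$$ and $G_{\alpha,n}(x)$ is asymptotically normal as $n\to\infty$ with mean $G^{(\alpha)}(x)$ and this variance, i.e. $\sqrt n\,\left(G_{\alpha,n}(x)-G^{(\alpha)}(x)\right)$ converges in distribution to $N\left(0,\ \Sigma_\alpha^2(x)/\Gamma^2(1-\alpha)\right)$.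
   Context: Class $K$: distribution functions $F$ on $\mathbb R$ for which there are $0\le a<b\le\infty$ with $F(a+0)=0$, $F(b-0)=1$, and $F$ continuous and strictly increasing on $(a,b)$. Here $a=0$. Riemann–Liouville fractional derivative: for $\gamma\in(0,1)$ and a measurable function $g$ on $(0,\infty)$, $$g^{(\gamma)}(x)=D^{\gamma}[g](x)=\frac{1}{\Gamma(1-\gamma)}\,\frac{d}{dx}\int_0^x\frac{g(t)\,dt}{(x-t)^{\gamma}},\qquad x>0.$$ "$g^{(\gamma)}(x)$ exists" means that this derivative exists (as a finite number) at the point $x$. For $h>0$ and $x>0$ put $f_{\alpha,h}(x)=x^{-\alpha}-(x-h)^{-\alpha}\,I(x>h)$, where $I$ is the indicator (the second term is $0$ when $x\le h$). The estimate of $G^{(\alpha)}(x)$ based on $\xi_1,\dots,\xi_n$ is $$G_{\alpha,n}(x)=\frac{1}{\Gamma(1-\alpha)}\cdot\frac1n\sum_{i=1}^n f_{\alpha,\xi_i}(x).$$ *)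

theory Defs
  imports "HOL-Probability.Probability"
begin

text \<open>
  The class K, with its endpoints exposed. The one-sided limit at \<open>b\<close> is taken in the
  extended reals, so that for \<open>b = \<infinity>\<close> it is the limit at infinity.
\<close>

definition class_K_on :: "(real \<Rightarrow> real) \<Rightarrow> ereal \<Rightarrow> ereal \<Rightarrow> bool" where
  "class_K_on F a b \<longleftrightarrow>
     (\<exists>\<mu>. real_distribution \<mu> \<and> F = cdf \<mu>) \<and>
     0 \<le> a \<and> a < b \<and>
     ((F \<circ> real_of_ereal) \<longlongrightarrow> 0) (at_right a) \<and>
     ((F \<circ> real_of_ereal) \<longlongrightarrow> 1) (at_left b) \<and>
     continuous_on (einterval a b) F \<and>
     strict_mono_on (einterval a b) F"

definition RL_integrand :: "real \<Rightarrow> (real \<Rightarrow> real) \<Rightarrow> real \<Rightarrow> real \<Rightarrow> real" where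
  "RL_integrand \<gamma> g y t = g t / (y - t) powr \<gamma>"

definition RL_integral :: "real \<Rightarrow> (real \<Rightarrow> real) \<Rightarrow> real \<Rightarrow> real" where
  "RL_integral \<gamma> g y = (LINT t:{0<..<y}|lborel. RL_integrand \<gamma> g y t)"

text \<open>
  Since Isabelle's integral of a non-integrable function is 0, existence of the fractional
  derivative at \<open>x\<close> also demands that the integral converges for all upper limits near \<open>x\<close>.
\<close>

definition frac_differentiable :: "real \<Rightarrow> (real \<Rightarrow> real) \<Rightarrow> real \<Rightarrow> bool" where
  "frac_differentiable \<gamma> g x \<longleftrightarrow>
     (\<forall>\<^sub>F y in nhds x. set_integrable lborel {0<..<y} (RL_integrand \<gamma> g y)) \<and>
     RL_integral \<gamma> g differentiable (at x)"

definition frac_deriv :: "real \<Rightarrow> (real \<Rightarrow> real) \<Rightarrow> real \<Rightarrow> real" where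
  "frac_deriv \<gamma> g x = 1 / Gamma (1 - \<gamma>) * deriv (RL_integral \<gamma> g) x"

definition f_kernel :: "real \<Rightarrow> real \<Rightarrow> real \<Rightarrow> real" where
  "f_kernel \<alpha> h x = x powr (-\<alpha>) - (if x > h then (x - h) powr (-\<alpha>) else 0)"

text \<open>The sample \<open>\<xi>\<^sub>1, \<dots>, \<xi>\<^sub>n\<close> is \<open>\<xi> 0, \<dots>, \<xi> (n - 1)\<close>.\<close>

definition G_est :: "real \<Rightarrow> (nat \<Rightarrow> 'a \<Rightarrow> real) \<Rightarrow> nat \<Rightarrow> real \<Rightarrow> 'a \<Rightarrow> real" where
  "G_est \<alpha> \<xi> n x \<omega> =
     1 / Gamma (1 - \<alpha>) * (1 / real n * (\<Sum>i<n. f_kernel \<alpha> (\<xi> i \<omega>) x))"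

definition Sigma_sq :: "real \<Rightarrow> (real \<Rightarrow> real) \<Rightarrow> real \<Rightarrow> real" where
  "Sigma_sq \<alpha> G x =
     2 * x powr (-\<alpha>) * Gamma (1 - \<alpha>) * frac_deriv \<alpha> G x
     - Gamma (1 - 2 * \<alpha>) * frac_deriv (2 * \<alpha>) G x
     - (Gamma (1 - \<alpha>) * frac_deriv \<alpha> G x)\<^sup>2"

end

theory Submission
  imports Defs
begin

text \<open>
  Let \<open>D\<close> be the law of \<open>\<xi> 0\<close>. By Fubini, the Riemann-Liouville integral of the survival function at
  \<open>y\<close> is \<open>(y powr (1 - \<gamma>) - \<Psi> y) / (1 - \<gamma>)\<close>, where \<open>\<Psi> y\<close> is the mean of
  \<open>max 0 (y - h) powr (1 - \<gamma>)\<close> over \<open>h\<close>. The left difference quotients of the latter function at \<open>x\<close>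
  are nonnegative, and bounded by \<open>max 0 (x - h) powr (-\<gamma>)\<close>, which is up to the factor \<open>1 - \<gamma>\<close> also
  their limit. If \<open>\<Psi>\<close> is differentiable at \<open>x\<close>, then Fatou's lemma shows that this bound is
  integrable, and dominated convergence identifies its mean. Taking \<open>\<gamma> = \<alpha>\<close> and \<open>\<gamma> = 2 * \<alpha>\<close> gives the
  first two moments of the kernel; the rest is the additivity of the variance and the central limit
  theorem. The latter needs a positive variance: the law has no atoms and charges \<open>(0, x)\<close>, where the
  kernel is injective.
\<close>

section \<open>The fractional integral of the survival function\<close>

text \<open>This is the inner integral of the Fubini step. The antiderivative is taken between
  \<open>0\<close> and \<open>min y h\<close>, and \<open>y - min y h = max 0 (y - h)\<close> merges
  the cases \<open>h < y\<close> and \<open>h \<ge> y\<close>.\<close>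

lemma nn_integral_truncated_power:
  fixes y h \<gamma> :: real
  assumes "\<gamma> < 1" "0 < y" "0 < h"
  shows "(\<integral>\<^sup>+ t. ennreal (indicator {0<..<y} t * indicator {..h} t * (y - t) powr (-\<gamma>)) \<partial>lborel)
       = ennreal ((y powr (1 - \<gamma>) - max 0 (y - h) powr (1 - \<gamma>)) / (1 - \<gamma>))"
proof -
  define m where "m = min y h"
  have m: "0 < m" "m \<le> y" using assms by (auto simp: m_def)
  let ?F = "\<lambda>t. - ((y - t) powr (1 - \<gamma>) / (1 - \<gamma>))"
  \<comment> \<open>If \<open>h \<ge> y\<close> and \<gamma> > 0, the integrand is singular at the
    upper end \<open>m = y\<close>; the interior form of the fundamental theorem asks only for
    continuity of \<open>?F\<close> there.\<close>
  have "((\<lambda>t. (y - t) powr (-\<gamma>)) has_integral (?F m - ?F 0)) {0..m}"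
  proof (rule fundamental_theorem_of_calculus_interior)
    show "continuous_on {0..m} ?F"
      using assms m by (intro continuous_intros continuous_on_powr') auto
    fix t assume t: "t \<in> {0<..<m}"
    have "((\<lambda>t. (y - t) powr (1 - \<gamma>)) has_real_derivative - ((1 - \<gamma>) * (y - t) powr (-\<gamma>))) (at t)"
      using DERIV_fun_powr[of "\<lambda>t. y - t" "-1" t "1 - \<gamma>"] t m
      by (auto intro!: derivative_eq_intros)
    from DERIV_minus[OF DERIV_cdivide[OF this, of "1 - \<gamma>"]]
    have "(?F has_real_derivative (y - t) powr (-\<gamma>)) (at t)"
      using assms by simp
    then show "(?F has_vector_derivative (y - t) powr (-\<gamma>)) (at t)"
      by (simp add: has_real_derivative_iff_has_vector_derivative)
  qed (use m in auto)
  then have "(\<integral>\<^sup>+ t. ennreal (indicator {0..m} t * (y - t) powr (-\<gamma>)) \<partial>lborel) = ennreal (?F m - ?F 0)"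
    by (subst nn_integral_has_integral_lebesgue) (auto simp: mult.commute)
  moreover have "?F m - ?F 0 = (y powr (1 - \<gamma>) - max 0 (y - h) powr (1 - \<gamma>)) / (1 - \<gamma>)"
    using assms by (auto simp: m_def min_def max_def divide_simps)
  \<comment> \<open>The two domains differ at most in the points \<open>0\<close> and
    \<open>y\<close>.\<close>
  moreover have "(\<integral>\<^sup>+ t. ennreal (indicator {0..m} t * (y - t) powr (-\<gamma>)) \<partial>lborel)
     = (\<integral>\<^sup>+ t. ennreal (indicator {0<..<y} t * indicator {..h} t * (y - t) powr (-\<gamma>)) \<partial>lborel)"
  proof (intro nn_integral_cong_AE)
    show "AE t in lborel. ennreal (indicator {0..m} t * (y - t) powr (-\<gamma>)) = 
       ennreal (indicator {0<..<y} t * indicator {..h} t * (y - t) powr (-\<gamma>))"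
      using AE_lborel_singleton[of 0] AE_lborel_singleton[of y]
      by eventually_elim (use m in \<open>auto simp: m_def indicator_def\<close>)
  qed
  ultimately show ?thesis by simp
qed

text \<open>Writing \<open>measure M {t..}\<close> as the mean over \<open>h\<close> of the
  indicator of \<open>t \<le> h\<close> produces a double integral. Its kernel \<open>?k\<close> is
  nonnegative, so the order is exchanged for \<open>nn_integral\<close> and the results are read
  back through \<open>enn2real\<close>.\<close>

lemma (in real_distribution) RL_integral_survival:
  assumes pos: "AE h in M. 0 < h" and "\<gamma> < 1" "0 < y"
  shows "RL_integral \<gamma> (\<lambda>t. measure M {t..}) y =
    expectation (\<lambda>h. (y powr (1 - \<gamma>) - max 0 (y - h) powr (1 - \<gamma>)) / (1 - \<gamma>))"
proof -
  interpret P: pair_sigma_finite M lborel by standard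
  have anti: "mono (\<lambda>t. - measure M {t..})"
    by (auto simp: mono_def intro!: finite_measure_mono)
  have Gm [measurable]: "(\<lambda>t. measure M {t..}) \<in> borel_measurable borel"
    using borel_measurable_mono[OF anti] by simp
  let ?k = "\<lambda>h t. indicator {0<..<y} t * indicator {..h} t * (y - t) powr (-\<gamma>) :: real"
  \<comment> \<open>The set \<open>{..h}\<close> varies with \<open>h\<close>; the comparison
    \<open>t \<le> h\<close> makes joint measurability visible.\<close>
  have [measurable]: "(\<lambda>(h, t). ?k h t) \<in> borel_measurable (M \<Otimes>\<^sub>M lborel)"
  proof -
    have "(\<lambda>(h, t). ?k h t) = (\<lambda>(h, t). indicator {0<..<y} t * (if t \<le> h then 1 else 0) * (y - t) powr (-\<gamma>))"
      by (auto simp: fun_eq_iff indicator_def)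
    then show ?thesis by simp
  qed
  have "ennreal (RL_integrand \<gamma> (\<lambda>t. measure M {t..}) y t * indicator {0<..<y} t)
     = (\<integral>\<^sup>+ h. ennreal (?k h t) \<partial>M)" for t
  proof -
    have "(\<integral>\<^sup>+ h. ennreal (?k h t) \<partial>M) =
      (\<integral>\<^sup>+ h. ennreal (indicator {0<..<y} t * (y - t) powr (-\<gamma>)) * indicator {t..} h \<partial>M)"
      by (intro nn_integral_cong) (auto simp: indicator_def)
    also have "\<dots> = ennreal (indicator {0<..<y} t * (y - t) powr (-\<gamma>)) * emeasure M {t..}"
      by (subst nn_integral_cmult) auto
    finally show ?thesis
      by (simp add: RL_integrand_def emeasure_eq_measure ennreal_mult'[symmetric] powr_minus
        divide_inverse mult_ac)
  qed
  then have "RL_integral \<gamma> (\<lambda>t. measure M {t..}) y = enn2real (\<integral>\<^sup>+ t. \<integral>\<^sup>+ h. ennreal (?k h t) \<partial>M \<partial>lborel)"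
    unfolding RL_integral_def set_lebesgue_integral_def
    by (subst integral_eq_nn_integral) (auto simp: RL_integrand_def mult.commute)
  also have "\<dots> = enn2real (\<integral>\<^sup>+ h. \<integral>\<^sup>+ t. ennreal (?k h t) \<partial>lborel \<partial>M)"
    by (subst P.Fubini') simp_all
  also have "(\<integral>\<^sup>+ h. \<integral>\<^sup>+ t. ennreal (?k h t) \<partial>lborel \<partial>M) =
     (\<integral>\<^sup>+ h. ennreal ((y powr (1 - \<gamma>) - max 0 (y - h) powr (1 - \<gamma>)) / (1 - \<gamma>)) \<partial>M)"
    by (intro nn_integral_cong_AE, use pos in eventually_elim)
      (rule nn_integral_truncated_power[OF assms(2,3)])
  also have "enn2real \<dots> = expectation (\<lambda>h. (y powr (1 - \<gamma>) - max 0 (y - h) powr (1 - \<gamma>)) / (1 - \<gamma>))"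
  proof (rule integral_eq_nn_integral[symmetric])
    show "AE h in M. 0 \<le> (y powr (1 - \<gamma>) - max 0 (y - h) powr (1 - \<gamma>)) / (1 - \<gamma>)"
      using pos by eventually_elim (use assms in \<open>auto intro!: divide_nonneg_nonneg powr_mono2\<close>)
  qed simp
  finally show ?thesis .
qed

section \<open>Left difference quotients of the truncated power\<close>

text \<open>For \<open>u > k\<close>, the power with exponent -\<gamma> decreases, so \<open>(u - k)
  powr (1 - \<gamma>) \<ge> (u - k) * u powr (-\<gamma>)\<close>; subtracting from
  \<open>u * u powr (-\<gamma>)\<close> leaves \<open>k\<close> times the bound. The bound is free
  of \<open>k\<close>, as domination requires, whereas the mean value theorem would give a power at
  a point between \<open>u - k\<close> and \<open>u\<close>.\<close>

lemma powr_left_quotient_le: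
  fixes u k \<gamma> :: real
  assumes "0 < \<gamma>" "0 < k"
  shows "(max 0 u powr (1 - \<gamma>) - max 0 (u - k) powr (1 - \<gamma>)) / k \<le> max 0 u powr (-\<gamma>)"
proof -
  consider "u \<le> 0" | "0 < u" "u \<le> k" | "k < u" by linarith
  then show ?thesis
  proof cases
    case 2
    then have "u powr (1 - \<gamma>) = u * u powr (-\<gamma>)" by (simp add: powr_diff powr_minus divide_inverse)
    also have "\<dots> \<le> k * u powr (-\<gamma>)" using 2 by (intro mult_right_mono) auto
    finally show ?thesis using 2 assms by (simp add: field_simps)
  next
    case 3
    have "u powr (1 - \<gamma>) - k * u powr (-\<gamma>) = (u - k) * u powr (-\<gamma>)"
      using 3 assms by (simp add: powr_diff powr_minus field_simps)
    also have "\<dots> \<le> (u - k) * (u - k) powr (-\<gamma>)"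
      using 3 assms by (intro mult_left_mono powr_mono2') auto
    also have "\<dots> = (u - k) powr (1 - \<gamma>)"
      using 3 assms by (simp add: powr_diff powr_minus field_simps)
    finally show ?thesis using 3 assms by (simp add: field_simps)
  qed (use assms in auto)
qed

lemma powr_left_quotient_nonneg:
  fixes u k \<gamma> :: real
  assumes "\<gamma> < 1" "0 < k"
  shows "0 \<le> (max 0 u powr (1 - \<gamma>) - max 0 (u - k) powr (1 - \<gamma>)) / k"
  using assms by (intro divide_nonneg_pos) (auto intro!: powr_mono2)

text \<open>For \<open>u \<le> 0\<close> the quotients and the limit vanish, because
  \<open>0 powr _ = 0\<close>. Approaching from the left matters at \<open>u = 0\<close>: for 0 <
  \<gamma> < 1 the right quotient there is \<open>k powr (-\<gamma>)\<close>, which is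
  unbounded.\<close>

lemma powr_left_quotient_tendsto:
  fixes u \<gamma> :: real
  assumes k: "k \<longlonglongrightarrow> 0" "\<And>n. 0 < k n"
  shows "(\<lambda>n. (max 0 u powr (1 - \<gamma>) - max 0 (u - k n) powr (1 - \<gamma>)) / k n)
          \<longlonglongrightarrow> (1 - \<gamma>) * max 0 u powr (-\<gamma>)"
proof (cases "u \<le> 0")
  case True
  then have "max 0 (u - k n) = 0" for n using k(2)[of n] by simp
  with True show ?thesis by simp
next
  case False
  have "((\<lambda>v. v powr (1 - \<gamma>)) has_real_derivative (1 - \<gamma>) * u powr (1 - \<gamma> - 1)) (at u)"
    using False by (intro has_real_derivative_powr) auto
  then have "((\<lambda>h. ((u + h) powr (1 - \<gamma>) - u powr (1 - \<gamma>)) / h) \<longlongrightarrow> (1 - \<gamma>) * u powr (-\<gamma>)) (at 0)"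
    by (simp add: DERIV_def)
  moreover have "filterlim (\<lambda>n. - k n) (at 0) sequentially"
    using tendsto_minus[OF k(1)] k(2) by (auto simp: filterlim_at less_imp_neq[symmetric])
  ultimately have "(\<lambda>n. ((u + - k n) powr (1 - \<gamma>) - u powr (1 - \<gamma>)) / - k n)
      \<longlonglongrightarrow> (1 - \<gamma>) * u powr (-\<gamma>)"
    by (rule filterlim_compose)
  \<comment> \<open>Once \<open>k n < u\<close>, the truncation is inactive and the two signs
    cancel.\<close>
  moreover have "\<forall>\<^sub>F n in sequentially. ((u + - k n) powr (1 - \<gamma>) - u powr (1 - \<gamma>)) / - k n
      = (max 0 u powr (1 - \<gamma>) - max 0 (u - k n) powr (1 - \<gamma>)) / k n"
    using order_tendstoD(2)[OF k(1), of u] False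
    by (auto elim!: eventually_mono simp: minus_divide_left)
  ultimately show ?thesis
    using False by (simp add: Lim_transform_eventually)
qed

section \<open>Moments of the kernel\<close>

lemma (in real_distribution) prob_UNIV [simp]: "prob UNIV = 1"
  using prob_space by simp

lemma (in real_distribution) frac_deriv_survival:
  assumes pos: "AE h in M. 0 < h" and \<gamma>: "0 < \<gamma>" "\<gamma> < 1" and x: "0 < x"
    and D: "frac_differentiable \<gamma> (\<lambda>t. measure M {t..}) x"
  shows "integrable M (\<lambda>h. max 0 (x - h) powr (-\<gamma>))" (is ?int)
    and "expectation (\<lambda>h. max 0 (x - h) powr (-\<gamma>))
      = x powr (-\<gamma>) - Gamma (1 - \<gamma>) * frac_deriv \<gamma> (\<lambda>t. measure M {t..}) x" (is ?eq)
proof -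
  let ?G = "\<lambda>t. measure M {t..}"
  define \<Psi> where "\<Psi> y = expectation (\<lambda>h. max 0 (y - h) powr (1 - \<gamma>))" for y
  \<comment> \<open>\<open>L\<close> is chosen so that \<Psi> has derivative
    \<open>(1 - \<gamma>) * L\<close> at \<open>x\<close>.\<close>
  define L where "L = x powr (-\<gamma>) - deriv (RL_integral \<gamma> ?G) x"
  define k where "k n = inverse (real (Suc n))" for n
  have k: "k \<longlonglongrightarrow> 0" "0 < k n" for n
    using LIMSEQ_inverse_real_of_nat by (simp_all add: k_def[abs_def] del: of_nat_Suc)
  \<comment> \<open>Almost surely \<open>h > 0\<close>, hence \<open>y - h < y\<close>, which gives
    a constant bound.\<close>
  have int: "integrable M (\<lambda>h. max 0 (y - h) powr (1 - \<gamma>))" for y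
  proof (rule integrable_const_bound)
    show "AE h in M. norm (max 0 (y - h) powr (1 - \<gamma>)) \<le> max 0 y powr (1 - \<gamma>)"
      using pos by eventually_elim (use \<gamma> in \<open>auto intro!: powr_mono2\<close>)
  qed simp
  have RL: "\<Psi> y = y powr (1 - \<gamma>) - (1 - \<gamma>) * RL_integral \<gamma> ?G y" if "0 < y" for y
    using RL_integral_survival[OF pos \<gamma>(2) that] \<gamma> int[of y]
    by (simp add: \<Psi>_def field_simps)
  have "(RL_integral \<gamma> ?G has_real_derivative deriv (RL_integral \<gamma> ?G) x) (at x)"
    using D by (simp add: frac_differentiable_def DERIV_deriv_iff_real_differentiable)
  from DERIV_diff[OF has_real_derivative_powr[OF x] DERIV_cmult[OF this], of "1 - \<gamma>" "1 - \<gamma>"]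
  have "((\<lambda>y. y powr (1 - \<gamma>) - (1 - \<gamma>) * RL_integral \<gamma> ?G y) has_real_derivative (1 - \<gamma>) * L) (at x)"
    by (simp add: L_def algebra_simps)
  \<comment> \<open>The formula \<open>RL\<close> covers \<open>y > 0\<close>, a neighbourhood of
    \<open>x\<close>, and the derivative at \<open>x\<close> sees only the germ.\<close>
  moreover have "\<forall>\<^sub>F y in nhds x. y powr (1 - \<gamma>) - (1 - \<gamma>) * RL_integral \<gamma> ?G y = \<Psi> y"
    using eventually_nhds_in_open[of "{0<..}" x] x by (auto elim!: eventually_mono simp: RL)
  ultimately have "(\<Psi> has_real_derivative (1 - \<gamma>) * L) (at x)"
    by (subst (asm) DERIV_cong_ev[OF refl _ refl]) auto
  then have "((\<lambda>h. (\<Psi> (x + h) - \<Psi> x) / h) \<longlongrightarrow> (1 - \<gamma>) * L) (at 0)"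
    by (simp add: DERIV_def)
  moreover have "filterlim (\<lambda>n. - k n) (at 0) sequentially"
    using tendsto_minus[OF k(1)] k(2) by (auto simp: filterlim_at less_imp_neq[symmetric])
  ultimately have "(\<lambda>n. (\<Psi> (x + - k n) - \<Psi> x) / - k n) \<longlonglongrightarrow> (1 - \<gamma>) * L"
    by (rule filterlim_compose)
  then have lim: "(\<lambda>n. (\<Psi> x - \<Psi> (x - k n)) / k n) \<longlonglongrightarrow> (1 - \<gamma>) * L"
    by (simp add: minus_divide_left)
  define Q where "Q n h = (max 0 (x - h) powr (1 - \<gamma>) - max 0 (x - h - k n) powr (1 - \<gamma>)) / k n" for n h
  have Qint: "integrable M (Q n)" for n
    using int[of x] int[of "x - k n"] by (simp add: Q_def[abs_def] algebra_simps)
  have EQ: "expectation (Q n) = (\<Psi> x - \<Psi> (x - k n)) / k n" for n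
    using int[of x] int[of "x - k n"] by (simp add: Q_def[abs_def] \<Psi>_def algebra_simps)
  have Qnn: "0 \<le> Q n h" for n h
    unfolding Q_def using k \<gamma> by (intro powr_left_quotient_nonneg) auto
  have Qle: "Q n h \<le> max 0 (x - h) powr (-\<gamma>)" for n h
    unfolding Q_def using k \<gamma> by (intro powr_left_quotient_le) auto
  have Qlim: "(\<lambda>n. Q n h) \<longlonglongrightarrow> (1 - \<gamma>) * max 0 (x - h) powr (-\<gamma>)" for h
    unfolding Q_def using k by (intro powr_left_quotient_tendsto) auto
  have EQlim: "(\<lambda>n. expectation (Q n)) \<longlonglongrightarrow> (1 - \<gamma>) * L"
    using lim by (simp add: EQ)
  have "(\<integral>\<^sup>+ h. ennreal ((1 - \<gamma>) * max 0 (x - h) powr (-\<gamma>)) \<partial>M) = (\<integral>\<^sup>+ h. liminf (\<lambda>n. ennreal (Q n h)) \<partial>M)"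
    using Qlim by (intro nn_integral_cong) (auto intro!: lim_imp_Liminf[symmetric] tendsto_ennrealI)
  also have "\<dots> \<le> liminf (\<lambda>n. \<integral>\<^sup>+ h. ennreal (Q n h) \<partial>M)"
    by (rule nn_integral_liminf) (simp add: Q_def)
  also have "\<dots> = liminf (\<lambda>n. ennreal (expectation (Q n)))"
    using Qint Qnn by (simp add: nn_integral_eq_integral)
  also have "\<dots> = ennreal ((1 - \<gamma>) * L)"
    using EQlim by (auto intro!: lim_imp_Liminf tendsto_ennrealI)
  finally have "integrable M (\<lambda>h. (1 - \<gamma>) * max 0 (x - h) powr (-\<gamma>))"
    using \<gamma> by (intro integrableI_nonneg) (auto simp: ennreal_less_top intro: le_less_trans)
  then show int': ?int
    using \<gamma> by simp
  \<comment> \<open>The dominating function is integrable by \<open>int'\<close>, which Fatou has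
    just supplied; it differs from the limit by the factor \<open>1 - \<gamma>\<close>.\<close>
  have "(\<lambda>n. expectation (Q n)) \<longlonglongrightarrow> expectation (\<lambda>h. (1 - \<gamma>) * max 0 (x - h) powr (-\<gamma>))"
    using Qlim Qnn Qle by (intro integral_dominated_convergence[OF _ _ int'])
      (auto intro: borel_measurable_integrable[OF Qint])
  from LIMSEQ_unique[OF EQlim this] have "expectation (\<lambda>h. max 0 (x - h) powr (-\<gamma>)) = L"
    using \<gamma> by simp
  moreover have "Gamma (1 - \<gamma>) > 0"
    using \<gamma> by (intro Gamma_real_pos) auto
  ultimately show ?eq
    by (simp add: L_def frac_deriv_def)
qed

text \<open>The convention \<open>0 powr _ = 0\<close> lets \<open>max\<close> absorb the indicator
  of \<open>x > h\<close>.\<close>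

lemma f_kernel_eq: "f_kernel \<alpha> h x = x powr (-\<alpha>) - max 0 (x - h) powr (-\<alpha>)"
  by (simp add: f_kernel_def)

lemma f_kernel_measurable [measurable]: "(\<lambda>h. f_kernel \<alpha> h x) \<in> borel_measurable borel"
  unfolding f_kernel_eq by simp

lemma (in real_distribution) f_kernel_mean:
  assumes pos: "AE h in M. 0 < h" and \<alpha>: "0 < \<alpha>" "\<alpha> < 1" and x: "0 < x"
    and D: "frac_differentiable \<alpha> (\<lambda>t. measure M {t..}) x"
  shows "integrable M (\<lambda>h. f_kernel \<alpha> h x)"
    and "expectation (\<lambda>h. f_kernel \<alpha> h x) = Gamma (1 - \<alpha>) * frac_deriv \<alpha> (\<lambda>t. measure M {t..}) x"
  using frac_deriv_survival[OF assms] by (simp_all add: f_kernel_eq)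

text \<open>Squaring the truncated power doubles its exponent, so the second moment is governed by
  the derivative of order 2\<alpha>, which is below 1. In the expanded square the terms
  \<open>x powr (-(2 * \<alpha>))\<close> cancel.\<close>

lemma (in real_distribution) f_kernel_variance:
  assumes pos: "AE h in M. 0 < h" and \<alpha>: "0 < \<alpha>" "\<alpha> < 1/2" and x: "0 < x"
    and D: "frac_differentiable \<alpha> (\<lambda>t. measure M {t..}) x"
    and D2: "frac_differentiable (2 * \<alpha>) (\<lambda>t. measure M {t..}) x"
  shows "integrable M (\<lambda>h. (f_kernel \<alpha> h x)\<^sup>2)" (is ?int)
    and "variance (\<lambda>h. f_kernel \<alpha> h x) = Sigma_sq \<alpha> (\<lambda>t. measure M {t..}) x" (is ?var)
proof -
  have "0 < 2 * \<alpha>" "2 * \<alpha> < 1" "\<alpha> < 1" using \<alpha> by auto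
  note I1 = frac_deriv_survival[OF pos \<alpha>(1) this(3) x D]
  note I2 = frac_deriv_survival[OF pos \<open>0 < 2 * \<alpha>\<close> \<open>2 * \<alpha> < 1\<close> x D2]
  have sq: "(v powr (-\<alpha>))\<^sup>2 = v powr (-(2 * \<alpha>))" for v :: real
    by (simp add: power2_eq_square powr_add[symmetric])
  have eq: "(f_kernel \<alpha> h x)\<^sup>2 =
    x powr (-(2 * \<alpha>)) - 2 * x powr (-\<alpha>) * max 0 (x - h) powr (-\<alpha>) + max 0 (x - h) powr (-(2 * \<alpha>))" for h
    unfolding f_kernel_eq power2_diff sq by simp
  show int2: ?int
    using I1(1) I2(1) unfolding eq by simp
  have "expectation (\<lambda>h. (f_kernel \<alpha> h x)\<^sup>2) =
    x powr (-(2 * \<alpha>)) - 2 * x powr (-\<alpha>) * (x powr (-\<alpha>) - Gamma (1 - \<alpha>) * frac_deriv \<alpha> (\<lambda>t. measure M {t..}) x)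
      + (x powr (-(2 * \<alpha>)) - Gamma (1 - 2 * \<alpha>) * frac_deriv (2 * \<alpha>) (\<lambda>t. measure M {t..}) x)"
    using I1 I2 unfolding eq by simp
  moreover have "x powr (-\<alpha>) * x powr (-\<alpha>) = x powr (-(2 * \<alpha>))"
    using sq[of x] by (simp add: power2_eq_square)
  ultimately show ?var
    using variance_eq[OF f_kernel_mean(1)[OF pos \<alpha>(1) \<open>\<alpha> < 1\<close> x D] int2] f_kernel_mean(2)[OF pos \<alpha>(1) \<open>\<alpha> < 1\<close> x D]
    unfolding Sigma_sq_def by (simp add: algebra_simps power2_eq_square)
qed

section \<open>Consequences of class K and nondegeneracy of the kernel\<close>

lemma (in real_distribution) class_K_on_0:
  assumes K: "class_K_on (cdf M) 0 b"
  shows "AE h in M. 0 < h" and "0 < h \<Longrightarrow> measure M {h} = 0" and "0 < x \<Longrightarrow> 0 < measure M {..<x}"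
proof -
  have b: "0 < b" and lim0: "((cdf M \<circ> real_of_ereal) \<longlongrightarrow> 0) (at_right 0)"
    and lim1: "((cdf M \<circ> real_of_ereal) \<longlongrightarrow> 1) (at_left b)"
    and cont: "continuous_on (einterval 0 b) (cdf M)" and mono: "strict_mono_on (einterval 0 b) (cdf M)"
    using K by (auto simp: class_K_on_def)
  \<comment> \<open>The limit in the extended reals becomes a real one; right continuity then
    identifies it with \<open>cdf M 0\<close>.\<close>
  have "(((cdf M \<circ> real_of_ereal) \<circ> ereal) \<longlongrightarrow> 0) (at_right 0)"
    using lim0 by (simp add: zero_ereal_def at_right_ereal filterlim_filtermap comp_def)
  then have "(cdf M \<longlongrightarrow> 0) (at_right 0)" by (simp add: comp_def)
  moreover have "(cdf M \<longlongrightarrow> cdf M 0) (at_right 0)"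
    using cdf_is_right_cont by (simp add: continuous_within)
  ultimately have "cdf M 0 = 0"
    using tendsto_unique trivial_limit_at_right_real by blast
  then have "AE h in M. h \<notin> {..0}"
    by (simp add: cdf_def AE_iff_measurable[OF _ refl] emeasure_eq_measure Collect_conv_if flip: atMost_def)
  then show "AE h in M. 0 < h" by eventually_elim auto
  show "measure M {h} = 0" if "0 < h" for h
  proof (cases "ereal h < b")
    case True
    then have "h \<in> einterval 0 b" using that by (simp add: einterval_def)
    then have "isCont (cdf M) h"
      using cont by (simp add: continuous_on_eq_continuous_at)
    then show ?thesis by (simp add: isCont_cdf)
  next
    case False
    \<comment> \<open>Here \<open>b\<close> is finite, and all the mass lies strictly to the left of
      \<open>b'\<close>, so none remains for \<open>h \<ge> b'\<close>.\<close>
    then obtain b' where b': "b = ereal b'" using b by (cases b) auto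
    have "(((cdf M \<circ> real_of_ereal) \<circ> ereal) \<longlongrightarrow> 1) (at_left b')"
      using lim1 by (simp add: b' at_left_ereal filterlim_filtermap comp_def)
    then have "(cdf M \<longlongrightarrow> 1) (at_left b')" by (simp add: comp_def)
    then have "measure M {..<b'} = 1"
      using tendsto_unique[OF _ cdf_at_left] trivial_limit_at_left_real by blast
    moreover have "measure M ({..<b'} \<union> {h}) = measure M {..<b'} + measure M {h}"
      using False b' by (intro finite_measure_Union) auto
    ultimately show ?thesis
      using prob_le_1[of "{..<b'} \<union> {h}"] measure_nonneg[of M "{h}"] by linarith
  qed
  show "0 < measure M {..<x}" if "0 < x" for x
  proof -
    have "0 < min (ereal x) b" using that b by simp
    \<comment> \<open>Both \<open>v / 2\<close> and \<open>v\<close> lie in the interval of strict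
      increase, and \<open>v < x\<close>; the mass between them is positive.\<close>
    then obtain v where v: "0 < ereal v" "ereal v < min (ereal x) b"
      by (metis ereal_dense2 zero_ereal_def)
    then have "cdf M (v / 2) < cdf M v"
      by (intro strict_mono_onD[OF mono]) (auto simp: einterval_def zero_ereal_def intro: less_trans[of _ "ereal v"])
    also have "\<dots> \<le> measure M {..<x}"
      unfolding cdf_def using v by (intro finite_measure_mono) auto
    finally show ?thesis using cdf_nonneg[of "v / 2"] by linarith
  qed
qed

text \<open>Zero variance would make the kernel almost surely a constant \<open>c\<close>. Being
  injective on (0, x), it takes the value \<open>c\<close> at no more than one point there, which is
  not an atom; yet (0, x) has positive mass.\<close>

lemma (in real_distribution) f_kernel_variance_pos:
  assumes K: "class_K_on (cdf M) 0 b" and \<alpha>: "0 < \<alpha>" and x: "0 < x"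
    and int: "integrable M (\<lambda>h. (f_kernel \<alpha> h x)\<^sup>2)"
  shows "0 < variance (\<lambda>h. f_kernel \<alpha> h x)"
proof (rule ccontr)
  note K' = class_K_on_0[OF K]
  let ?f = "\<lambda>h. f_kernel \<alpha> h x"
  have int1: "integrable M ?f"
    by (rule square_integrable_imp_integrable[OF _ int]) simp
  define c where "c = expectation ?f"
  assume "\<not> 0 < variance ?f"
  moreover have int2: "integrable M (\<lambda>h. (?f h - c)\<^sup>2)"
    using int int1 by (simp add: power2_diff)
  moreover have "0 \<le> variance ?f" by simp
  ultimately have "variance ?f = 0" by linarith
  then have ae: "AE h in M. ?f h = c"
    using integral_nonneg_eq_0_iff_AE[OF int2] by (simp add: c_def)
  have "AE h in M. \<not> h < x"
  proof (cases "\<exists>h0. 0 < h0 \<and> h0 < x \<and> ?f h0 = c")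
    case True
    then obtain h0 where h0: "0 < h0" "h0 < x" "?f h0 = c" by blast
    have "AE h in M. h \<notin> {h0}"
      using K'(2)[OF h0(1)] by (intro AE_not_in) (auto simp: null_sets_def emeasure_eq_measure)
    with ae K'(1) show ?thesis
    proof eventually_elim
      case (elim h)
      show ?case
      proof
        assume "h < x"
        then have "(x - h) powr (-\<alpha>) = (x - h0) powr (-\<alpha>)"
          using elim h0 by (simp add: f_kernel_def)
        \<comment> \<open>Raising both sides to the inverse exponent undoes the power, as \<alpha>
          is nonzero.\<close>
        then have "x - h = x - h0"
          using \<alpha> \<open>h < x\<close> h0 by (metis powr_inj neg_equal_0_iff_equal diff_gt_0_iff_gt
            less_irrefl powr_powr right_inverse powr_one less_imp_le)
        with elim show False by simp
      qed
    qed
  next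
    case False
    show ?thesis using ae K'(1) by eventually_elim (use False in blast)
  qed
  then have "AE h in M. h \<notin> {..<x}" by simp
  then have "measure M {..<x} = 0"
    by (subst prob_eq_0) auto
  with K'(3)[OF x] show False by simp
qed

section \<open>Scaling of the normal limit and variance of independent sums\<close>

text \<open>Scaling by \<sigma> > 0 moves the argument of a distribution function from
  \<open>t\<close> to \<open>t / \<sigma>\<close>. The standard normal one is continuous everywhere,
  so convergence is available at each such point.\<close>

lemma weak_conv_m_mult_std_normal:
  fixes X :: "nat \<Rightarrow> 'a \<Rightarrow> real"
  assumes "0 < \<sigma>" and [measurable]: "\<And>n. X n \<in> borel_measurable M"
    and conv: "weak_conv_m (\<lambda>n. distr M borel (X n)) std_normal_distribution"
  shows "weak_conv_m (\<lambda>n. distr M borel (\<lambda>\<omega>. \<sigma> * X n \<omega>)) (density lborel (normal_density 0 \<sigma>))"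
proof -
  have cdf_scale: "cdf (distr N borel (\<lambda>\<omega>. \<sigma> * Y \<omega>)) t = cdf (distr N borel Y) (t / \<sigma>)"
    if [measurable]: "Y \<in> borel_measurable N" for N :: "'b measure" and Y t
  proof -
    have "{\<omega> \<in> space N. \<sigma> * Y \<omega> \<le> t} = {\<omega> \<in> space N. Y \<omega> \<le> t / \<sigma>}"
      using assms(1) by (auto simp: field_simps)
    then show ?thesis by (simp add: cdf_def measure_distr vimage_def Int_def conj_commute)
  qed
  interpret N: real_distribution std_normal_distribution by (rule real_dist_normal_dist)
  have "distributed std_normal_distribution lborel (\<lambda>t. t) std_normal_density"
    by (auto simp: distributed_def distr_id2)
  from N.normal_density_affine[OF this, of \<sigma> 0] assms(1)
  have dens: "density lborel (normal_density 0 \<sigma>) = distr std_normal_distribution borel (\<lambda>t. \<sigma> * t)"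
    by (auto simp: distributed_def cong: distr_cong)
  have "isCont (cdf std_normal_distribution) t" for t
  proof -
    have "emeasure std_normal_distribution {t} = 0"
      by (subst emeasure_density) (auto simp: nn_integral_0_iff_AE intro!: AE_mp[OF AE_lborel_singleton[of t]])
    then show ?thesis by (simp add: N.isCont_cdf measure_def)
  qed
  then show ?thesis
    using conv unfolding weak_conv_m_def weak_conv_def dens
    by (auto simp: cdf_scale cdf_scale[of "\<lambda>t. t" std_normal_distribution] distr_id2)
qed

text \<open>Square integrability of the partial sum is carried through the induction together with
  the variance. The new summand is independent of the partial sum, so the mean of their product
  factors and the cross terms cancel.\<close>

lemma (in prob_space) variance_sum_indep:
  fixes X :: "'i \<Rightarrow> 'a \<Rightarrow> real"
  assumes "finite I" "indep_vars (\<lambda>_. borel) X I" "\<And>i. i \<in> I \<Longrightarrow> integrable M (\<lambda>\<omega>. (X i \<omega>)\<^sup>2)"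
  shows "integrable M (\<lambda>\<omega>. (\<Sum>i\<in>I. X i \<omega>)\<^sup>2) \<and>
    variance (\<lambda>\<omega>. \<Sum>i\<in>I. X i \<omega>) = (\<Sum>i\<in>I. variance (X i))"
  using assms
proof (induction I)
  case (insert i I)
  have ind: "indep_vars (\<lambda>_. borel) X I"
    using insert.prems(1) by (rule indep_vars_subset) auto
  note IH = insert.IH[OF ind insert.prems(2), simplified]
  have rv: "random_variable borel (X j)" if "j \<in> insert i I" for j
    using insert.prems(1) that unfolding indep_vars_def by auto
  have int1: "integrable M (X j)" if "j \<in> insert i I" for j
    using insert.prems(2)[OF that] rv[OF that] by (rule square_integrable_imp_integrable[rotated])
  let ?S = "\<lambda>\<omega>. \<Sum>i\<in>I. X i \<omega>"
  have S: "integrable M ?S" "integrable M (\<lambda>\<omega>. (?S \<omega>)\<^sup>2)"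
    using int1 IH by auto
  have indep: "indep_var borel (X i) borel ?S"
    using insert by (intro indep_vars_sum) auto
  have XS: "integrable M (\<lambda>\<omega>. X i \<omega> * ?S \<omega>)"
     "expectation (\<lambda>\<omega>. X i \<omega> * ?S \<omega>) = expectation (X i) * expectation ?S"
    using indep_var_integrable[OF indep] indep_var_lebesgue_integral[OF indep] int1 S by auto
  have Xi: "integrable M (X i)" "integrable M (\<lambda>\<omega>. (X i \<omega>)\<^sup>2)"
    using int1 insert.prems(2) by auto
  have sq: "(X i \<omega> + ?S \<omega>)\<^sup>2 = (X i \<omega>)\<^sup>2 + (?S \<omega>)\<^sup>2 + 2 * (X i \<omega> * ?S \<omega>)" for \<omega>
    by (simp add: power2_sum)
  have int2: "integrable M (\<lambda>\<omega>. (X i \<omega> + ?S \<omega>)\<^sup>2)"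
    unfolding sq using Xi S XS by simp
  have "variance (\<lambda>\<omega>. X i \<omega> + ?S \<omega>) = variance (X i) + variance ?S"
    using Xi S XS int2
    by (subst (1 2 3) variance_eq) (simp_all add: sq power2_eq_square algebra_simps del: Bochner_Integration.integral_sum)
  with IH int2 insert.hyps show ?case by simp
qed simp

section \<open>Transfer from the common law to the sample\<close>

theorem theorem2p1:
  fixes M :: "'a measure" and \<xi> :: "nat \<Rightarrow> 'a \<Rightarrow> real"
    and F G :: "real \<Rightarrow> real" and b :: ereal and \<alpha> x :: real
  assumes "0 < \<alpha>" and "\<alpha> < 1/2"
    and "prob_space M"
    and "prob_space.indep_vars M (\<lambda>_. borel) \<xi> UNIV"
    and "\<And>i. cdf (distr M borel (\<xi> i)) = F"
    and "class_K_on F 0 b"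
    and "\<And>t. G t = measure M {\<omega> \<in> space M. \<xi> 0 \<omega> \<ge> t}"
    and "x > 0"
  shows
    "(frac_differentiable \<alpha> G x \<longrightarrow>
       (\<forall>n\<ge>1. integrable M (G_est \<alpha> \<xi> n x) \<and>
         prob_space.expectation M (G_est \<alpha> \<xi> n x) = frac_deriv \<alpha> G x)) \<and>
     (frac_differentiable \<alpha> G x \<and> frac_differentiable (2 * \<alpha>) G x \<longrightarrow>
       (\<forall>n\<ge>1. integrable M (\<lambda>\<omega>. (G_est \<alpha> \<xi> n x \<omega>)\<^sup>2) \<and>
         prob_space.variance M (G_est \<alpha> \<xi> n x)
           = Sigma_sq \<alpha> G x / (real n * (Gamma (1 - \<alpha>))\<^sup>2)) \<and>
       weak_conv_m
         (\<lambda>n. distr M borel (\<lambda>\<omega>. sqrt (real n) * (G_est \<alpha> \<xi> n x \<omega> - frac_deriv \<alpha> G x)))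
         (density lborel (normal_density 0 (sqrt (Sigma_sq \<alpha> G x / (Gamma (1 - \<alpha>))\<^sup>2)))))"
proof -
  interpret prob_space M by fact
  define D where "D = distr M borel (\<xi> 0)"
  have rv [measurable]: "random_variable borel (\<xi> i)" for i
    using assms(4) by (simp add: indep_vars_def)
  have rd: "real_distribution (distr M borel (\<xi> i))" for i
    by (simp add: real_distribution_def real_distribution_axioms_def prob_space_distr)
  interpret D: real_distribution D
    unfolding D_def by (rule rd)
  \<comment> \<open>A distribution function determines its law.\<close>
  have distr: "distr M borel (\<xi> i) = D" for i
    unfolding D_def using assms(5) by (intro cdf_unique rd) simp
  have K: "class_K_on (cdf D) 0 b"
    using assms(5,6) by (simp add: D_def)
  have pos: "AE h in D. 0 < h"
    using D.class_K_on_0(1)[OF K] .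
  have G: "G = (\<lambda>t. measure D {t..})"
    by (auto simp: assms(7) D_def measure_distr vimage_def Int_def fun_eq_iff conj_commute)
  have \<Gamma>: "Gamma (1 - \<alpha>) > 0"
    using assms(1,2) by (intro Gamma_real_pos) auto
  define X where "X i \<omega> = f_kernel \<alpha> (\<xi> i \<omega>) x" for i \<omega>
  have X [measurable]: "random_variable borel (X i)" for i
    unfolding X_def by measurable
  \<comment> \<open>The free \<open>g\<close> covers the mean, the second moment and the centred
    square at once.\<close>
  have EX: "expectation (\<lambda>\<omega>. g (X i \<omega>)) = D.expectation (\<lambda>h. g (f_kernel \<alpha> h x))"
    and IX: "integrable M (\<lambda>\<omega>. g (X i \<omega>)) \<longleftrightarrow> integrable D (\<lambda>h. g (f_kernel \<alpha> h x))"
    if [measurable]: "g \<in> borel_measurable borel" for g :: "real \<Rightarrow> real" and i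
    unfolding distr[of i, symmetric] X_def by (simp_all add: integral_distr integrable_distr_eq)
  \<comment> \<open>The scalar stands on the right, in the form that
    \<open>integral_mult_left_zero\<close> pulls out.\<close>
  have est: "G_est \<alpha> \<xi> n x = (\<lambda>\<omega>. (\<Sum>i<n. X i \<omega>) * (1 / (Gamma (1 - \<alpha>) * real n)))" for n
    by (simp add: G_est_def X_def fun_eq_iff)
  show ?thesis
  proof (intro conjI impI allI)
    assume A: "frac_differentiable \<alpha> G x"
    have "\<alpha> < 1" using assms(2) by simp
    note f = D.f_kernel_mean[OF pos assms(1) this assms(8) A[unfolded G], folded G]
    have int: "integrable M (X i)" and mean: "expectation (X i) = Gamma (1 - \<alpha>) * frac_deriv \<alpha> G x" for i
      using f EX[of "\<lambda>v. v" i] IX[of "\<lambda>v. v" i] by simp_all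
    fix n :: nat assume "1 \<le> n"
    show "integrable M (G_est \<alpha> \<xi> n x)"
      unfolding est using int by simp
    show "expectation (G_est \<alpha> \<xi> n x) = frac_deriv \<alpha> G x"
      unfolding est using int mean \<Gamma> \<open>1 \<le> n\<close> by simp
  next
    assume A: "frac_differentiable \<alpha> G x \<and> frac_differentiable (2 * \<alpha>) G x"
    have "\<alpha> < 1" using assms(2) by simp
    note f1 = D.f_kernel_mean[OF pos assms(1) this assms(8) conjunct1[OF A, unfolded G], folded G]
    note f2 = D.f_kernel_variance[OF pos assms(1,2,8) conjunct1[OF A, unfolded G]
        conjunct2[OF A, unfolded G], folded G]
    define S where "S = Sigma_sq \<alpha> G x"
    have S: "0 < S"
      unfolding S_def f2(2)[symmetric] by (rule D.f_kernel_variance_pos[OF K assms(1,8) f2(1)])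
    have int: "integrable M (X i)" and mean: "expectation (X i) = Gamma (1 - \<alpha>) * frac_deriv \<alpha> G x"
      and int2: "integrable M (\<lambda>\<omega>. (X i \<omega>)\<^sup>2)" for i
      using f1 f2(1) EX[of "\<lambda>v. v" i] IX[of "\<lambda>v. v" i] IX[of "\<lambda>v. v\<^sup>2" i] by simp_all
    have var: "variance (X i) = S" for i
      using EX[of "\<lambda>v. (v - expectation (X i))\<^sup>2" i] EX[of "\<lambda>v. v" i] f2(2) by (simp add: S_def)
    have indep: "indep_vars (\<lambda>_. borel) X UNIV"
      unfolding X_def using assms(4) by (rule indep_vars_compose2) simp
    {
      fix n :: nat assume n: "1 \<le> n"
      have sum: "integrable M (\<lambda>\<omega>. (\<Sum>i<n. X i \<omega>)\<^sup>2)" "variance (\<lambda>\<omega>. \<Sum>i<n. X i \<omega>) = real n * S"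
        using variance_sum_indep[of "{..<n}" X] indep_vars_subset[OF indep, of "{..<n}"] int2
        by (simp_all add: var)
      show "integrable M (\<lambda>\<omega>. (G_est \<alpha> \<xi> n x \<omega>)\<^sup>2)"
        unfolding est power_mult_distrib using sum(1) by simp
      let ?c = "1 / (Gamma (1 - \<alpha>) * real n)"
      have "variance (G_est \<alpha> \<xi> n x) =
          expectation (\<lambda>\<omega>. ((\<Sum>i<n. X i \<omega>) - expectation (\<lambda>\<omega>. \<Sum>i<n. X i \<omega>))\<^sup>2 * ?c\<^sup>2)"
        unfolding est integral_mult_left_zero left_diff_distrib[symmetric] power_mult_distrib ..
      also have "\<dots> = real n * S * ?c\<^sup>2"
        unfolding integral_mult_left_zero sum(2) ..
      also have "\<dots> = S / (real n * (Gamma (1 - \<alpha>))\<^sup>2)"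
        using n by (simp add: power2_eq_square field_simps)
      finally show "variance (G_est \<alpha> \<xi> n x) = Sigma_sq \<alpha> G x / (real n * (Gamma (1 - \<alpha>))\<^sup>2)"
        by (simp add: S_def)
    }
    let ?\<sigma> = "sqrt (S / (Gamma (1 - \<alpha>))\<^sup>2)"
    let ?m = "Gamma (1 - \<alpha>) * frac_deriv \<alpha> G x"
    \<comment> \<open>The form \<open>(sqrt S)\<^sup>2\<close> matches the central limit theorem
      with standard deviation \<open>sqrt S\<close>, positive by \<open>S\<close>.\<close>
    let ?Z = "\<lambda>n \<omega>. (\<Sum>i<n. X i \<omega> - ?m) / sqrt (real n * (sqrt S)\<^sup>2)"
    have "distr M borel (X n) = distr D borel (\<lambda>h. f_kernel \<alpha> h x)" for n
      unfolding distr[of n, symmetric] X_def by (simp add: distr_distr comp_def)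
    then have "weak_conv_m (\<lambda>n. distr M borel (?Z n)) std_normal_distribution"
      using indep mean int2 var S by (intro central_limit_theorem) auto
    then have "weak_conv_m (\<lambda>n. distr M borel (\<lambda>\<omega>. ?\<sigma> * ?Z n \<omega>)) (density lborel (normal_density 0 ?\<sigma>))"
      using S \<Gamma> by (intro weak_conv_m_mult_std_normal) auto
    \<comment> \<open>The equality is wanted for every \<open>n\<close>, including
      \<open>n = 0\<close>, where both sides are \<open>0\<close>. Otherwise
      \<open>real n = r * r\<close> turns it into a rational identity in \<open>r\<close>.\<close>
    moreover have "?\<sigma> * ?Z n \<omega> = sqrt (real n) * (G_est \<alpha> \<xi> n x \<omega> - frac_deriv \<alpha> G x)" for n \<omega>
    proof (cases "n = 0")
      case False
      define r where "r = sqrt (real n)"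
      have r: "0 < r" "real n = r * r" using False by (auto simp: r_def)
      then show ?thesis
        using S \<Gamma> by (simp add: est real_sqrt_mult real_sqrt_divide sum_subtractf field_simps)
    qed simp
    ultimately show "weak_conv_m
       (\<lambda>n. distr M borel (\<lambda>\<omega>. sqrt (real n) * (G_est \<alpha> \<xi> n x \<omega> - frac_deriv \<alpha> G x)))
       (density lborel (normal_density 0 (sqrt (Sigma_sq \<alpha> G x / (Gamma (1 - \<alpha>))\<^sup>2))))"
      by (simp add: S_def)
  qed
qed

end
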